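(* Let $X=[0,1]$ and let $(T,X,\mu)$ be a dynamical system, where $\mu$ is a $T$-invariant probability measure that is absolutely continuous with respect to Lebesgue measure with density bounded above, i.e. $\frac{d\mu}{d\mathrm{Leb}}\le C_\mu$ for some constant $C_\mu$. Fix $z\in X$ and consider the observable $\varphi(x):=|\log d(x,z)|$. Let $\mathcal{L}$ be the transfer operator of $T$ with respect to $\mu$, and assume that it has exponential decay in the space of $\alpha$-Hölder functions, that is, there exist constants $\theta>0$ and $C_{\mathcal{L}}>0$ such that $$\|\mathcal{L}^nf\|_\alpha\le C_{\mathcal{L}}e^{-\theta n}\|f\|_\alpha\qquad\text{for all } n \text{ and all } \alpha\text{-Hölder } f \text{ with } \int f\,d\mu=0.$$ Then for every $\varepsilon>0$ there exist constants $n_0(\varepsilon)\in\mathbb{N}$ and $c(\varepsilon)>0$ such that for all $n\ge n_0(\varepsilon)$, $$\mu\left(\left|S_n\left(\varphi-\int\varphi\,d\mu\right)\right|>n\varepsilon\right)\le\exp\left(-c(\varepsilon)\,\varepsilon\,n^{1/3}\right),$$ where $S_n(\psi):=\sum_{k=0}^{n-1}\psi\circ T^k$ denotes the Birkhoff sum.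
   Context: $d(x,z)=|x-z|$ is the usual distance on $[0,1]$. The exponent $\alpha$ is a fixed Hölder exponent, and $\|\cdot\|_\alpha$ is the Hölder norm on $C^\alpha([0,1])$ (sup norm plus $\alpha$-Hölder seminorm). The transfer operator with respect to $\mu$ is the operator $\mathcal{L}$ determined by $\int(\mathcal{L}f)\,g\,d\mu=\int f\,(g\circ T)\,d\mu$ for $f\in L^1(\mu)$, $g\in L^\infty(\mu)$. *)

theory Defs
  imports "HOL-Probability.Probability"
begin

abbreviation unit_Leb :: "real measure" where
  "unit_Leb \<equiv> restrict_space lborel {0..1}"

definition invariant_prob :: "real measure \<Rightarrow> (real \<Rightarrow> real) \<Rightarrow> bool" where
  "invariant_prob M T \<longleftrightarrow>
     prob_space M \<and> sets M = sets unit_Leb \<and> T \<in> measurable M M \<and> distr M M T = M"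

definition bounded_density :: "real measure \<Rightarrow> real \<Rightarrow> bool" where
  "bounded_density M C \<longleftrightarrow>
     absolutely_continuous unit_Leb M \<and>
     (AE x in unit_Leb. RN_deriv unit_Leb M x \<le> ennreal C)"

definition holder_fun :: "real \<Rightarrow> (real \<Rightarrow> real) \<Rightarrow> bool" where
  "holder_fun \<alpha> f \<longleftrightarrow>
     (\<exists>K. \<forall>x\<in>{0..1}. \<forall>y\<in>{0..1}. \<bar>f x - f y\<bar> \<le> K * \<bar>x - y\<bar> powr \<alpha>)"

text \<open>The suprema below are meaningful only for functions satisfying \<^const>\<open>holder_fun\<close>;
  the norm is only ever applied to such functions.\<close>

definition holder_seminorm :: "real \<Rightarrow> (real \<Rightarrow> real) \<Rightarrow> real" where
  "holder_seminorm \<alpha> f =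
     (SUP (x, y) \<in> {(x, y). x \<in> {0..1} \<and> y \<in> {0..1} \<and> x \<noteq> y}.
        \<bar>f x - f y\<bar> / \<bar>x - y\<bar> powr \<alpha>)"

definition holder_norm :: "real \<Rightarrow> (real \<Rightarrow> real) \<Rightarrow> real" where
  "holder_norm \<alpha> f = (SUP x \<in> {0..1}. \<bar>f x\<bar>) + holder_seminorm \<alpha> f"

text \<open>Elements of \<open>L\<^sup>1\<close> are represented by functions, so the duality relation determines
  \<open>L f\<close> up to a null set; \<open>L\<close> is any choice of versions.\<close>

definition transfer_operator ::
    "real measure \<Rightarrow> (real \<Rightarrow> real) \<Rightarrow> ((real \<Rightarrow> real) \<Rightarrow> real \<Rightarrow> real) \<Rightarrow> bool" where
  "transfer_operator M T L \<longleftrightarrow>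
     (\<forall>f. integrable M f \<longrightarrow>
        integrable M (L f) \<and>
        (\<forall>g \<in> borel_measurable M. (\<exists>B. AE x in M. \<bar>g x\<bar> \<le> B) \<longrightarrow>
           (\<integral>x. L f x * g x \<partial>M) = (\<integral>x. f x * g (T x) \<partial>M)))"

text \<open>Since \<open>(L ^^ n) f\<close> is an almost-everywhere class, its Hoelder norm is that of a Hoelder
  version \<open>h\<close>.\<close>

definition holder_exp_decay ::
    "real measure \<Rightarrow> real \<Rightarrow> ((real \<Rightarrow> real) \<Rightarrow> real \<Rightarrow> real) \<Rightarrow> bool" where
  "holder_exp_decay M \<alpha> L \<longleftrightarrow>
     (\<exists>\<theta>>0. \<exists>C>0. \<forall>n::nat. \<forall>f. holder_fun \<alpha> f \<and> (\<integral>x. f x \<partial>M) = 0 \<longrightarrow>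
        (\<exists>h. holder_fun \<alpha> h \<and> (AE x in M. h x = (L ^^ n) f x) \<and>
             holder_norm \<alpha> h \<le> C * exp (- \<theta> * real n) * holder_norm \<alpha> f))"

definition birkhoff_sum :: "(real \<Rightarrow> real) \<Rightarrow> nat \<Rightarrow> (real \<Rightarrow> real) \<Rightarrow> real \<Rightarrow> real" where
  "birkhoff_sum T n \<psi> x = (\<Sum>k<n. \<psi> ((T ^^ k) x))"

text \<open>At \<open>x = z\<close> the value is \<open>0\<close> (as \<open>ln 0 = 0\<close>) instead of \<open>\<infinity>\<close>; for an invariant measure
  without atoms the set of points whose orbit meets \<open>z\<close> is null.\<close>

definition log_dist_obs :: "real \<Rightarrow> real \<Rightarrow> real" where
  "log_dist_obs z x = \<bar>ln (dist x z)\<bar>"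

end

theory Submission
  imports Defs "HOL-Real_Asymp.Real_Asymp"
begin

text \<open>
  Decay of correlations makes a bounded Lipschitz observable, sampled along the orbit at times that
  are a gap \<open>p\<close> apart, behave like independent variables as far as exponential moments are
  concerned. For a nonnegative Lipschitz \<open>F\<close> and a nonnegative bounded \<open>g\<close>, moving \<open>T ^^ p\<close> to the
  other side by duality gives
  \<open>\<integral>F \<cdot> (g \<circ> T ^^ p) \<le> (\<integral>F + \<eta>) \<cdot> \<integral>g\<close>, with \<open>\<eta>\<close> equal to \<open>C * exp (- \<theta> * p)\<close> times the Hoelder
  norm of \<open>F\<close> (lemma \<open>holder_decay_decorrelation\<close>;
  \<open>C\<close> and \<open>\<theta>\<close> are the decay constants). Iterating over a product yields
  \<open>\<integral>\<Prod>j<N. F \<circ> T ^^ (p * j) \<le> (\<integral>F + \<eta>) ^ N\<close>.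

  The observable \<open>\<phi> = \<bar>ln \<bar>x - z\<bar>\<bar>\<close> is unbounded, but the density bound gives it an exponential
  moment. Hence, with \<open>m\<close> its mean and \<open>l > 0\<close> small (independently of \<open>n\<close>), the functions
  \<open>F = exp (l * (\<plusminus>(\<phi> - m) - \<epsilon>))\<close> have integral at most \<open>exp (- l * \<epsilon> / 2) < 1\<close>. To have Lipschitz
  functions, \<open>\<phi>\<close> is replaced by its truncation at height \<open>t\<close>, at the price of a Hoelder norm of order
  \<open>exp (2 * t)\<close>. A gap \<open>p\<close> proportional to \<open>t\<close> makes \<open>\<eta>\<close> of order \<open>exp (- t)\<close>, so that \<open>\<integral>F + \<eta>\<close> stays
  below a fixed \<open>exp (- \<kappa>) < 1\<close>. Splitting the times below \<open>n\<close> into residue classes modulo \<open>p\<close> and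
  using Markov's inequality in each class bounds either tail of the truncated Birkhoff sum
  by \<open>p * exp (- \<kappa> * (n div p))\<close> (lemma \<open>trunc_birkhoff_tail\<close>).

  The truncation changes the Birkhoff sum only if the orbit comes within \<open>exp (- t)\<close> of \<open>z\<close> before
  time \<open>n\<close>, an event of probability at most \<open>n\<close> times a multiple of \<open>exp (- t)\<close>. For
  \<open>t = n powr (1/3)\<close> the tails are of order \<open>exp (- n powr (2/3))\<close> up to constants in the exponent
  and polynomial factors, and the sum of all three terms is eventually at most \<open>exp (- t / 2)\<close>.
\<close>

section \<open>Iterating the map and its transfer operator\<close>

lemma invariant_prob_space:
  assumes "invariant_prob M T"
  shows "space M = {0..1}" and "borel_measurable borel \<subseteq> borel_measurable M"
proof -
  have s: "sets M = sets unit_Leb"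
    using assms by (simp add: invariant_prob_def)
  show "space M = {0..1}"
    using sets_eq_imp_space_eq[OF s] by (simp add: space_restrict_space)
  show "borel_measurable borel \<subseteq> borel_measurable M"
    using measurable_restrict_space1[of _ lborel borel "{0..1}"]
    by (auto simp: measurable_cong_sets[OF s refl])
qed

lemma invariant_prob_iterate:
  assumes "invariant_prob M T"
  shows "T ^^ n \<in> measurable M M" and "distr M M (T ^^ n) = M"
proof -
  have T: "T \<in> measurable M M" "distr M M T = M"
    using assms by (auto simp: invariant_prob_def)
  have "T ^^ n \<in> measurable M M \<and> distr M M (T ^^ n) = M"
  proof (induction n)
    case 0
    then show ?case by (simp add: id_def distr_id[unfolded id_def])
  next
    case (Suc n)
    have "T \<circ> (T ^^ n) \<in> measurable M M"
      using Suc T by (intro measurable_comp[of _ M M]) auto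
    moreover have "distr M M (T \<circ> (T ^^ n)) = distr (distr M M (T ^^ n)) M T"
      using Suc T by (subst distr_distr) auto
    ultimately show ?case using Suc T by (metis funpow.simps(2))
  qed
  then show "T ^^ n \<in> measurable M M" "distr M M (T ^^ n) = M" by auto
qed

lemma invariant_integral_iterate:
  fixes g :: "real \<Rightarrow> real"
  assumes "invariant_prob M T" and "g \<in> borel_measurable M"
  shows "(\<integral>x. g ((T ^^ n) x) \<partial>M) = (\<integral>x. g x \<partial>M)"
  using integral_distr[OF invariant_prob_iterate(1)[OF assms(1), of n] assms(2)]
    invariant_prob_iterate(2)[OF assms(1), of n] by simp

lemma transfer_operator_iterate:
  assumes inv: "invariant_prob M T" and L: "transfer_operator M T L"
    and f: "integrable M f"
    and g: "g \<in> borel_measurable M" "\<And>x. x \<in> space M \<Longrightarrow> \<bar>g x\<bar> \<le> B"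
  shows "(\<integral>x. (L ^^ n) f x * g x \<partial>M) = (\<integral>x. f x * g ((T ^^ n) x) \<partial>M)"
proof -
  have T: "T \<in> measurable M M" using inv by (simp add: invariant_prob_def)
  have int: "integrable M ((L ^^ k) f)" for k
    using f L by (induction k) (auto simp: transfer_operator_def)
  show ?thesis
    using g
  proof (induction n arbitrary: g)
    case 0
    then show ?case by simp
  next
    case (Suc n)
    have gT: "(\<lambda>x. g (T x)) \<in> borel_measurable M"
      using T Suc.prems(1) by measurable
    have "AE x in M. \<bar>g x\<bar> \<le> B" using Suc.prems(2) by auto
    then have "(\<integral>x. (L ^^ Suc n) f x * g x \<partial>M) = (\<integral>x. (L ^^ n) f x * g (T x) \<partial>M)"
      using L int[of n] Suc.prems(1) unfolding transfer_operator_def by auto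
    also have "\<dots> = (\<integral>x. f x * g (T ((T ^^ n) x)) \<partial>M)"
      using Suc.prems(2) measurable_space[OF T] by (intro Suc.IH[OF gT]) auto
    finally show ?case by simp
  qed
qed

section \<open>Hoelder decay turned into a one-sided decorrelation estimate\<close>

lemma abs_le_holder_norm:
  assumes \<alpha>: "0 < \<alpha>" and h: "holder_fun \<alpha> h" and x: "x \<in> {0..1}"
  shows "\<bar>h x\<bar> \<le> holder_norm \<alpha> h"
proof -
  obtain K where K: "\<And>x y. x \<in> {0..1} \<Longrightarrow> y \<in> {0..1} \<Longrightarrow> \<bar>h x - h y\<bar> \<le> K * \<bar>x - y\<bar> powr \<alpha>"
    using h unfolding holder_fun_def by blast
  let ?q = "\<lambda>(x, y). \<bar>h x - h y\<bar> / \<bar>x - y\<bar> powr \<alpha>"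
  let ?S = "{(x, y). x \<in> {0..1} \<and> y \<in> {0..1} \<and> x \<noteq> (y::real)}"
  have K0: "0 \<le> K" using K[of 0 1] by simp
  have "\<bar>h y\<bar> \<le> \<bar>h 0\<bar> + K" if y: "y \<in> {0..1}" for y
  proof -
    have "\<bar>y - 0\<bar> powr \<alpha> \<le> 1" using y \<alpha> by (auto intro!: powr_le1)
    then have "K * \<bar>y - 0\<bar> powr \<alpha> \<le> K" using K0 by (intro mult_left_le) auto
    then show ?thesis using K[OF y, of 0] by auto
  qed
  then have "bdd_above ((\<lambda>x. \<bar>h x\<bar>) ` {0..1})" by (intro bdd_aboveI2) auto
  then have sup: "\<bar>h x\<bar> \<le> (SUP x\<in>{0..1}. \<bar>h x\<bar>)" using x by (rule cSUP_upper2) simp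
  have "bdd_above (?q ` ?S)"
    using K by (intro bdd_aboveI2[where M = K]) (auto simp: divide_le_eq)
  moreover have "(0, 1) \<in> ?S" by simp
  moreover have "0 \<le> ?q (0, 1)" by simp
  ultimately have "0 \<le> (SUP p\<in>?S. ?q p)" by (meson cSUP_upper2)
  then show ?thesis using sup by (simp add: holder_norm_def holder_seminorm_def)
qed

text \<open>On an interval of length one, \<open>\<bar>x - y\<bar> \<le> \<bar>x - y\<bar> powr \<alpha>\<close>, so a Lipschitz constant is
  a Hoelder constant for every exponent up to one.\<close>

lemma lipschitz_holder:
  assumes \<alpha>: "0 < \<alpha>" "\<alpha> \<le> 1"
    and B: "\<And>x. x \<in> {0..1} \<Longrightarrow> \<bar>f x\<bar> \<le> B"
    and lip: "\<And>x y. x \<in> {0..1} \<Longrightarrow> y \<in> {0..1} \<Longrightarrow> \<bar>f x - f y\<bar> \<le> \<Lambda> * \<bar>x - y\<bar>"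
  shows "holder_fun \<alpha> f" and "holder_norm \<alpha> f \<le> B + \<Lambda>"
proof -
  have \<Lambda>: "0 \<le> \<Lambda>" using lip[of 0 1] by simp
  have *: "\<bar>f x - f y\<bar> \<le> \<Lambda> * \<bar>x - y\<bar> powr \<alpha>" if xy: "x \<in> {0..1}" "y \<in> {0..1}" for x y
  proof -
    have "\<bar>x - y\<bar> \<le> \<bar>x - y\<bar> powr \<alpha>"
    proof (cases "x = y")
      case False
      then show ?thesis using xy \<alpha> powr_mono'[of \<alpha> 1 "\<bar>x - y\<bar>"] by auto
    qed auto
    then show ?thesis using lip[OF xy] mult_left_mono[OF _ \<Lambda>] by fastforce
  qed
  then show "holder_fun \<alpha> f" unfolding holder_fun_def by blast
  have "(SUP x\<in>{0..1}. \<bar>f x\<bar>) \<le> B" using B by (intro cSUP_least) auto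
  moreover have "holder_seminorm \<alpha> f \<le> \<Lambda>"
    unfolding holder_seminorm_def
  proof (rule cSUP_least)
    have "(0, 1) \<in> {(x, y). x \<in> {0..1} \<and> y \<in> {0..1} \<and> x \<noteq> (y::real)}" by simp
    then show "{(x, y). x \<in> {0..1} \<and> y \<in> {0..1} \<and> x \<noteq> (y::real)} \<noteq> {}" by blast
  qed (use * in \<open>auto simp: divide_le_eq\<close>)
  ultimately show "holder_norm \<alpha> f \<le> B + \<Lambda>" by (simp add: holder_norm_def)
qed

text \<open>The iterate \<open>(L ^^ p)\<close> applied to the centred function \<open>F - \<integral>F\<close> has a version of supremum
  norm at most its Hoelder norm. Since \<open>g\<close> is nonnegative, this pointwise bound can be integrated
  against \<open>g\<close>. The error is \<^emph>\<open>relative\<close> to \<open>\<integral>g\<close>, which is what allows the estimate to be iterated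
  over products of many factors.\<close>

lemma holder_decay_decorrelation:
  assumes \<alpha>: "0 < \<alpha>" "\<alpha> \<le> 1" and inv: "invariant_prob M T" and L: "transfer_operator M T L"
    and C: "0 \<le> C"
    and decay: "\<And>n f. holder_fun \<alpha> f \<Longrightarrow> (\<integral>x. f x \<partial>M) = 0 \<Longrightarrow>
      \<exists>h. holder_fun \<alpha> h \<and> (AE x in M. h x = (L ^^ n) f x) \<and>
          holder_norm \<alpha> h \<le> C * exp (- \<theta> * real n) * holder_norm \<alpha> f"
    and F: "F \<in> borel_measurable M" "\<And>x. x \<in> {0..1} \<Longrightarrow> 0 \<le> F x \<and> F x \<le> B"
    and lip: "\<And>x y. x \<in> {0..1} \<Longrightarrow> y \<in> {0..1} \<Longrightarrow> \<bar>F x - F y\<bar> \<le> \<Lambda> * \<bar>x - y\<bar>"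
    and g: "g \<in> borel_measurable M" "\<And>x. x \<in> space M \<Longrightarrow> 0 \<le> g x \<and> g x \<le> D"
  shows "(\<integral>x. F x * g ((T ^^ p) x) \<partial>M)
    \<le> ((\<integral>x. F x \<partial>M) + C * exp (- \<theta> * real p) * (B + \<Lambda>)) * (\<integral>x. g x \<partial>M)"
proof -
  interpret prob_space M using inv by (simp add: invariant_prob_def)
  note sp = invariant_prob_space(1)[OF inv]
  note Tp = invariant_prob_iterate(1)[OF inv, of p]
  have intF: "integrable M F"
    using F sp by (intro integrable_const_bound[of F B] AE_I2) auto
  have intg: "integrable M g"
    using g by (intro integrable_const_bound[of g D] AE_I2) auto
  have gT: "(\<lambda>x. g ((T ^^ p) x)) \<in> borel_measurable M" using Tp g(1) by measurable
  have gTb: "0 \<le> g ((T ^^ p) x) \<and> g ((T ^^ p) x) \<le> D" if "x \<in> space M" for x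
    using g(2) measurable_space[OF Tp that] by auto
  have intgT: "integrable M (\<lambda>x. g ((T ^^ p) x))"
    using gT gTb by (intro integrable_const_bound[of _ D] AE_I2) auto
  have intFgT: "integrable M (\<lambda>x. F x * g ((T ^^ p) x))"
    using F(1) gT gTb F(2) sp
    by (intro integrable_const_bound[of _ "B * D"] AE_I2)
       (auto simp: abs_mult intro!: mult_mono order_trans[of 0 "F _" B])
  define m where "m = (\<integral>x. F x \<partial>M)"
  have m: "0 \<le> m" "m \<le> B"
    unfolding m_def
    using F sp intF
    by (auto intro!: Bochner_Integration.integral_nonneg_AE AE_I2 integral_le_const)
  define f where "f = (\<lambda>x. F x - m)"
  have intf: "integrable M f" using intF by (simp add: f_def)
  have f0: "(\<integral>x. f x \<partial>M) = 0"
    using intF by (simp add: f_def m_def prob_space)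
  have fb: "\<bar>f x\<bar> \<le> B" if "x \<in> {0..1}" for x
    using F(2)[OF that] m by (auto simp: f_def)
  have "\<bar>f x - f y\<bar> \<le> \<Lambda> * \<bar>x - y\<bar>" if "x \<in> {0..1}" "y \<in> {0..1}" for x y
    using lip[OF that] by (simp add: f_def)
  note fh = lipschitz_holder[OF \<alpha> fb this]
  define \<eta> where "\<eta> = C * exp (- \<theta> * real p) * (B + \<Lambda>)"
  obtain h where h: "holder_fun \<alpha> h" "AE x in M. h x = (L ^^ p) f x"
      "holder_norm \<alpha> h \<le> C * exp (- \<theta> * real p) * holder_norm \<alpha> f"
    using decay[OF fh(1) f0, of p] by blast
  have "C * exp (- \<theta> * real p) * holder_norm \<alpha> f \<le> \<eta>"
    unfolding \<eta>_def using C fh(2) by (intro mult_left_mono) auto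
  then have hb: "\<bar>h x\<bar> \<le> \<eta>" if "x \<in> {0..1}" for x
    using abs_le_holder_norm[OF \<alpha>(1) h(1) that] h(3) by linarith
  have h\<eta>: "AE x in M. \<bar>(L ^^ p) f x\<bar> \<le> \<eta>"
    using h(2) AE_space by eventually_elim (use hb sp in force)
  have "integrable M ((L ^^ p) f)"
    using intf L by (induction p) (auto simp: transfer_operator_def)
  then have Lm: "(L ^^ p) f \<in> borel_measurable M" by auto
  have "(\<integral>x. f x * g ((T ^^ p) x) \<partial>M) = (\<integral>x. (L ^^ p) f x * g x \<partial>M)"
    using g by (intro transfer_operator_iterate[OF inv L intf, symmetric]) auto
  also have "\<dots> \<le> (\<integral>x. \<eta> * g x \<partial>M)"
  proof (rule integral_mono_AE)
    show "AE x in M. (L ^^ p) f x * g x \<le> \<eta> * g x"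
      using h\<eta> AE_space by eventually_elim (use g(2) in \<open>auto intro!: mult_right_mono\<close>)
    show "integrable M (\<lambda>x. \<eta> * g x)" using intg by simp
    then show "integrable M (\<lambda>x. (L ^^ p) f x * g x)"
    proof (rule Bochner_Integration.integrable_bound)
      show "(\<lambda>x. (L ^^ p) f x * g x) \<in> borel_measurable M" using Lm g(1) by measurable
      show "AE x in M. norm ((L ^^ p) f x * g x) \<le> norm (\<eta> * g x)"
        using h\<eta> AE_space
        by eventually_elim (use g(2) in \<open>auto simp: abs_mult intro!: mult_mono\<close>)
    qed
  qed
  also have "\<dots> = \<eta> * (\<integral>x. g x \<partial>M)" by simp
  finally have "(\<integral>x. f x * g ((T ^^ p) x) \<partial>M) \<le> \<eta> * (\<integral>x. g x \<partial>M)" .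
  moreover have "(\<integral>x. f x * g ((T ^^ p) x) \<partial>M)
      = (\<integral>x. F x * g ((T ^^ p) x) \<partial>M) - m * (\<integral>x. g x \<partial>M)"
    using intFgT intgT invariant_integral_iterate[OF inv g(1), of p]
    by (simp add: f_def left_diff_distrib)
  ultimately show ?thesis unfolding m_def[symmetric] \<eta>_def[symmetric]
    by (simp add: distrib_right)
qed

section \<open>Large deviations of bounded observables from decorrelation\<close>

text \<open>Peeling off the first factor leaves the remaining product composed with \<open>T ^^ p\<close>, so each
  factor costs one application of the decorrelation hypothesis.\<close>

lemma integral_iterate_product_le:
  fixes F :: "real \<Rightarrow> real"
  assumes inv: "invariant_prob M T" and a: "0 \<le> a"
    and F: "F \<in> borel_measurable M" "\<And>x. x \<in> space M \<Longrightarrow> 0 \<le> F x \<and> F x \<le> B"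
    and decorr: "\<And>g D. g \<in> borel_measurable M \<Longrightarrow> (\<And>x. x \<in> space M \<Longrightarrow> 0 \<le> g x \<and> g x \<le> D) \<Longrightarrow>
      (\<integral>x. F x * g ((T ^^ p) x) \<partial>M) \<le> a * (\<integral>x. g x \<partial>M)"
  shows "(\<integral>x. (\<Prod>j<N. F ((T ^^ (p * j)) x)) \<partial>M) \<le> a ^ N"
proof (induction N)
  case 0
  interpret prob_space M using inv by (simp add: invariant_prob_def)
  show ?case by (simp add: prob_space)
next
  case (Suc N)
  define g where "g = (\<lambda>x. \<Prod>j<N. F ((T ^^ (p * j)) x))"
  have "(\<lambda>x. F ((T ^^ (p * j)) x)) \<in> borel_measurable M" for j
    using measurable_compose[OF invariant_prob_iterate(1)[OF inv] F(1)] .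
  then have gm: "g \<in> borel_measurable M" unfolding g_def by measurable
  have Fj: "0 \<le> F ((T ^^ j) x) \<and> F ((T ^^ j) x) \<le> B" if "x \<in> space M" for x j
    using F(2) measurable_space[OF invariant_prob_iterate(1)[OF inv] that] by blast
  have "0 \<le> g x \<and> g x \<le> (\<Prod>j<N. B)" if "x \<in> space M" for x
    unfolding g_def using Fj[OF that] by (intro conjI prod_nonneg prod_mono) auto
  note * = decorr[OF gm this]
  have "(T ^^ (p * Suc j)) x = (T ^^ (p * j)) ((T ^^ p) x)" for x j
    using funpow_add[of "p * j" p T] by (simp add: add.commute)
  then have "(\<Prod>j<Suc N. F ((T ^^ (p * j)) x)) = F x * g ((T ^^ p) x)" for x
    unfolding g_def prod.lessThan_Suc_shift by simp
  then have "(\<integral>x. (\<Prod>j<Suc N. F ((T ^^ (p * j)) x)) \<partial>M) \<le> a * (\<integral>x. g x \<partial>M)"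
    using * by simp
  also have "\<dots> \<le> a * a ^ N" using Suc a by (intro mult_left_mono) (auto simp: g_def)
  finally show ?case by simp
qed

lemma residue_class_lessThan:
  fixes n p r :: nat
  assumes "r < p"
  shows "{k. k < n \<and> k mod p = r} = (\<lambda>j. p * j + r) ` {..<(n + p - 1 - r) div p}"
proof -
  have *: "j < (n + p - 1 - r) div p \<longleftrightarrow> p * j + r < n" for j
  proof -
    have "j < (n + p - 1 - r) div p \<longleftrightarrow> Suc j * p \<le> n + p - 1 - r"
      using assms by (simp add: less_eq_div_iff_mult_less_eq Suc_le_eq[symmetric])
    also have "\<dots> \<longleftrightarrow> p * j + r < n" using assms by (auto simp: algebra_simps)
    finally show ?thesis .
  qed
  show ?thesis
  proof (intro equalityI subsetI)
    fix k assume k: "k \<in> {k. k < n \<and> k mod p = r}"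
    then have "k = p * (k div p) + r" by (metis (mono_tags) mem_Collect_eq mult_div_mod_eq)
    with k show "k \<in> (\<lambda>j. p * j + r) ` {..<(n + p - 1 - r) div p}"
      using *[of "k div p"] by (intro image_eqI[of _ _ "k div p"]) auto
  next
    fix k assume "k \<in> (\<lambda>j. p * j + r) ` {..<(n + p - 1 - r) div p}"
    then obtain j where "j < (n + p - 1 - r) div p" and k: "k = p * j + r" by blast
    then have "k < n" using * by blast
    then show "k \<in> {k. k < n \<and> k mod p = r}" using assms k by simp
  qed
qed

text \<open>The indices below \<open>n\<close> are split into their residue classes modulo \<open>p\<close>. A positive Birkhoff sum
  forces a positive sum over some class, and within a class consecutive times differ by \<open>p\<close>, so that
  Markov's inequality for the exponential of that sum and the product estimate apply. Every
  class has at least \<open>n div p\<close> elements.\<close>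

lemma birkhoff_sum_positive_prob:
  fixes w :: "real \<Rightarrow> real"
  assumes inv: "invariant_prob M T" and a: "0 \<le> a" "a \<le> 1" and p: "0 < p"
    and w: "w \<in> borel_measurable M" "\<And>x. x \<in> space M \<Longrightarrow> exp (w x) \<le> B"
    and decorr: "\<And>g D. g \<in> borel_measurable M \<Longrightarrow> (\<And>x. x \<in> space M \<Longrightarrow> 0 \<le> g x \<and> g x \<le> D) \<Longrightarrow>
      (\<integral>x. exp (w x) * g ((T ^^ p) x) \<partial>M) \<le> a * (\<integral>x. g x \<partial>M)"
  shows "measure M {x \<in> space M. birkhoff_sum T n w x > 0} \<le> real p * a ^ (n div p)"
proof -
  interpret prob_space M using inv by (simp add: invariant_prob_def)
  have wT: "(\<lambda>x. w ((T ^^ k) x)) \<in> borel_measurable M" for k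
    using measurable_compose[OF invariant_prob_iterate(1)[OF inv] w(1)] .
  define N where "N r = (n + p - 1 - r) div p" for r
  define S where "S r x = (\<Sum>j<N r. w ((T ^^ (p * j + r)) x))" for r x
  define A where "A r = {x \<in> space M. S r x \<ge> 0}" for r
  have Sm: "S r \<in> borel_measurable M" for r unfolding S_def using wT by measurable
  have Am: "A r \<in> sets M" for r unfolding A_def using Sm by measurable
  have split: "birkhoff_sum T n w x = (\<Sum>r<p. S r x)" for x
  proof -
    have "(\<Sum>k<n. w ((T ^^ k) x)) = (\<Sum>r<p. \<Sum>k\<in>{k\<in>{..<n}. k mod p = r}. w ((T ^^ k) x))"
      using p by (intro sum.group[symmetric]) auto
    also have "\<dots> = (\<Sum>r<p. S r x)"
    proof (rule sum.cong[OF refl])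
      fix r assume "r \<in> {..<p}"
      then have r: "r < p" by simp
      have "{k\<in>{..<n}. k mod p = r} = (\<lambda>j. p * j + r) ` {..<N r}"
        using residue_class_lessThan[OF r, of n] by (simp add: N_def)
      moreover have "inj_on (\<lambda>j. p * j + r) {..<N r}" using p by (auto simp: inj_on_def)
      ultimately show "(\<Sum>k\<in>{k\<in>{..<n}. k mod p = r}. w ((T ^^ k) x)) = S r x"
        by (simp add: sum.reindex S_def)
    qed
    finally show ?thesis by (simp add: birkhoff_sum_def)
  qed
  have class_prob: "measure M (A r) \<le> a ^ (n div p)" if "r < p" for r
  proof -
    define G where "G x = (\<Prod>j<N r. exp (w ((T ^^ (p * j)) x)))" for x
    have Gm: "G \<in> borel_measurable M" unfolding G_def using wT by measurable
    have GS: "G ((T ^^ r) x) = exp (S r x)" for x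
      unfolding G_def S_def exp_sum[OF finite_lessThan] by (simp add: funpow_add)
    have wb: "exp (w ((T ^^ k) x)) \<le> B" if "x \<in> space M" for x k
      using w(2) measurable_space[OF invariant_prob_iterate(1)[OF inv] that] by blast
    have "exp (S r x) \<le> (\<Prod>j<N r. B)" if "x \<in> space M" for x
      unfolding S_def exp_sum[OF finite_lessThan] using wb[OF that] by (intro prod_mono) auto
    then have int: "integrable M (\<lambda>x. exp (S r x))"
      using Sm by (intro integrable_const_bound[of _ "\<Prod>j<N r. B"] AE_I2) auto
    have "A r = {x \<in> space M. exp (S r x) \<ge> 1}" unfolding A_def by auto
    then have "measure M (A r) \<le> (\<integral>x. exp (S r x) \<partial>M) / 1"
      using integral_Markov_inequality_measure[OF int Am, of 1] by simp
    also have "\<dots> = (\<integral>x. G x \<partial>M)"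
      using invariant_integral_iterate[OF inv Gm, of r] by (simp add: GS)
    also have "\<dots> \<le> a ^ N r"
      unfolding G_def using w decorr
      by (intro integral_iterate_product_le[OF inv a(1), of "\<lambda>x. exp (w x)" B]) auto
    also have "\<dots> \<le> a ^ (n div p)"
      using a that by (intro power_decreasing) (auto simp: N_def intro!: div_le_mono)
    finally show ?thesis .
  qed
  have "{x \<in> space M. birkhoff_sum T n w x > 0} \<subseteq> (\<Union>r<p. A r)"
  proof
    fix x assume x: "x \<in> {x \<in> space M. birkhoff_sum T n w x > 0}"
    then have "\<exists>r<p. 0 \<le> S r x"
      using sum_nonpos[of "{..<p}" "\<lambda>r. S r x"] unfolding split
      by (metis (mono_tags, lifting) lessThan_iff linorder_not_le mem_Collect_eq order_less_imp_le)
    then show "x \<in> (\<Union>r<p. A r)" using x by (auto simp: A_def)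
  qed
  then have "measure M {x \<in> space M. birkhoff_sum T n w x > 0} \<le> measure M (\<Union>r<p. A r)"
    using Am by (intro finite_measure_mono) auto
  also have "\<dots> \<le> (\<Sum>r<p. measure M (A r))"
    using Am by (intro finite_measure_subadditive_finite) auto
  also have "\<dots> \<le> (\<Sum>r<p. a ^ (n div p))" using class_prob by (intro sum_mono) auto
  finally show ?thesis by simp
qed

section \<open>Integrals against a measure of bounded density\<close>

lemma bounded_density_nn_integral_le:
  assumes inv: "invariant_prob M T" and dens: "bounded_density M C"
    and f[measurable]: "f \<in> borel_measurable borel"
  shows "(\<integral>\<^sup>+x. f x \<partial>M) \<le> ennreal C * (\<integral>\<^sup>+x\<in>{0..1}. f x \<partial>lborel)"
proof -
  interpret U: sigma_finite_measure unit_Leb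
    by (intro sigma_finite_measure_restrict_space sigma_finite_lborel) auto
  have fU: "f \<in> borel_measurable unit_Leb"
    by (intro measurable_restrict_space1) simp
  have "density unit_Leb (RN_deriv unit_Leb M) = M"
    using inv dens by (intro U.density_RN_deriv) (auto simp: invariant_prob_def bounded_density_def)
  then have "(\<integral>\<^sup>+x. f x \<partial>M) = (\<integral>\<^sup>+x. f x \<partial>density unit_Leb (RN_deriv unit_Leb M))" by simp
  also have "\<dots> = (\<integral>\<^sup>+x. RN_deriv unit_Leb M x * f x \<partial>unit_Leb)"
    using fU by (intro nn_integral_density) auto
  also have "\<dots> \<le> (\<integral>\<^sup>+x. ennreal C * f x \<partial>unit_Leb)"
  proof (rule nn_integral_mono_AE)
    have "AE x in unit_Leb. RN_deriv unit_Leb M x \<le> ennreal C"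
      using dens by (simp add: bounded_density_def)
    then show "AE x in unit_Leb. RN_deriv unit_Leb M x * f x \<le> ennreal C * f x"
      by eventually_elim (auto intro: mult_right_mono)
  qed
  also have "\<dots> = ennreal C * (\<integral>\<^sup>+x. f x \<partial>unit_Leb)"
    using fU by (intro nn_integral_cmult) auto
  also have "(\<integral>\<^sup>+x. f x \<partial>unit_Leb) = (\<integral>\<^sup>+x\<in>{0..1}. f x \<partial>lborel)"
    by (simp add: nn_integral_restrict_space)
  finally show ?thesis .
qed

lemma bounded_density_ball_prob:
  assumes inv: "invariant_prob M T" and dens: "bounded_density M C" and \<delta>: "0 \<le> \<delta>"
  shows "measure M {x \<in> space M. \<bar>x - z\<bar> < \<delta>} \<le> \<bar>C\<bar> * (2 * \<delta>)"
proof -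
  interpret prob_space M using inv by (simp add: invariant_prob_def)
  let ?B = "{z - \<delta><..<z + \<delta>}"
  have eq: "{x \<in> space M. \<bar>x - z\<bar> < \<delta>} = space M \<inter> ?B" by auto
  have "(indicator ?B :: real \<Rightarrow> real) \<in> borel_measurable M"
    using invariant_prob_space(2)[OF inv] by (auto intro: borel_measurable_indicator)
  then have sB: "space M \<inter> ?B \<in> sets M" by (simp add: borel_measurable_indicator_iff Int_commute)
  have "emeasure M (space M \<inter> ?B) = (\<integral>\<^sup>+x. indicator (space M \<inter> ?B) x \<partial>M)"
    using sB by simp
  also have "\<dots> = (\<integral>\<^sup>+x. indicator ?B x \<partial>M)"
    by (intro nn_integral_cong) (auto simp: indicator_def)
  also have "\<dots> \<le> ennreal C * (\<integral>\<^sup>+x\<in>{0..1}. indicator ?B x \<partial>lborel)"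
    by (intro bounded_density_nn_integral_le[OF inv dens]) auto
  also have "\<dots> \<le> ennreal \<bar>C\<bar> * (\<integral>\<^sup>+x. indicator ?B x \<partial>lborel)"
    by (intro mult_mono nn_integral_mono ennreal_leI) (auto simp: indicator_def)
  also have "\<dots> = ennreal (\<bar>C\<bar> * (2 * \<delta>))"
    using \<delta> by (simp add: ennreal_mult' mult.commute)
  finally have "emeasure M (space M \<inter> ?B) \<le> ennreal (\<bar>C\<bar> * (2 * \<delta>))" .
  then show ?thesis using \<delta> unfolding eq emeasure_eq_measure by (simp add: ennreal_le_iff)
qed

lemma bounded_density_AE_neq:
  assumes inv: "invariant_prob M T" and dens: "bounded_density M C"
  shows "AE x in M. x \<noteq> z"
proof -
  have "(\<integral>\<^sup>+x. indicator {z} x \<partial>M) \<le> ennreal C * (\<integral>\<^sup>+x\<in>{0..1}. indicator {z} x \<partial>lborel)"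
    by (intro bounded_density_nn_integral_le[OF inv dens]) auto
  also have "\<dots> \<le> ennreal C * (\<integral>\<^sup>+x. indicator {z} x \<partial>lborel)"
    by (intro mult_left_mono nn_integral_mono) (auto simp: indicator_def)
  also have "\<dots> = 0" by simp
  finally have "(\<integral>\<^sup>+x. indicator {z} x \<partial>M) = 0" by simp
  moreover have "(indicator {z} :: real \<Rightarrow> ennreal) \<in> borel_measurable M"
  proof -
    have "(indicator {z} :: real \<Rightarrow> real) \<in> borel_measurable M"
      using invariant_prob_space(2)[OF inv] by (auto intro: borel_measurable_indicator)
    then show ?thesis by (simp add: borel_measurable_indicator_iff)
  qed
  ultimately have "AE x in M. (indicator {z} x :: ennreal) = 0"
    by (subst (asm) nn_integral_0_iff_AE) auto
  then show ?thesis by (auto simp: indicator_def elim!: eventually_mono split: if_splits)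
qed

section \<open>The logarithmic singularity and its truncations\<close>

text \<open>The singularity \<open>\<bar>x - z\<bar> powr (- 1/2)\<close> is Lebesgue integrable, so \<open>\<bar>ln \<bar>x - z\<bar>\<bar>\<close> has an
  exponential moment.\<close>

lemma log_dist_obs_exp_moment:
  assumes inv: "invariant_prob M T" and dens: "bounded_density M C" and z: "z \<in> {0..1}"
  shows "integrable M (\<lambda>x. exp (log_dist_obs z x / 2))"
proof -
  define h :: "real \<Rightarrow> real" where "h u = (if u \<in> {0..1} then u powr (- 1/2) else 0)" for u
  have h[measurable]: "h \<in> borel_measurable borel" unfolding h_def by measurable
  have h0: "0 \<le> h u" for u by (simp add: h_def)
  have "((\<lambda>u. u powr (- 1/2)) has_integral (1 powr (- 1/2 + 1) / (- 1/2 + 1))) {0..1::real}"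
    by (rule has_integral_powr_from_0) auto
  then have "(h has_integral (1 powr (- 1/2 + 1) / (- 1/2 + 1))) UNIV"
    unfolding h_def by (subst has_integral_restrict_UNIV)
  then have I: "(\<integral>\<^sup>+u. h u \<partial>lborel) < \<infinity>"
    using nn_integral_has_integral_lborel[OF h h0] by simp
  have I1: "(\<integral>\<^sup>+x. h (x - z) \<partial>lborel) < \<infinity>"
    using I nn_integral_real_affine[of "\<lambda>u. ennreal (h u)" 1 "- z"] by simp
  have I2: "(\<integral>\<^sup>+x. h (z - x) \<partial>lborel) < \<infinity>"
    using I nn_integral_real_affine[of "\<lambda>u. ennreal (h u)" "- 1" z] by simp
  \<comment> \<open>The summand 1 covers the point \<open>x = z\<close>, where the observable is 0 and so is the power.\<close>
  have bound: "exp (log_dist_obs z x / 2) \<le> 1 + h (x - z) + h (z - x)" if x: "x \<in> {0..1}" for x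
  proof (cases "x = z")
    case True
    then show ?thesis using h0 by (simp add: log_dist_obs_def)
  next
    case False
    have d: "0 < \<bar>x - z\<bar>" "\<bar>x - z\<bar> \<le> 1" using x z False by auto
    then have "log_dist_obs z x = - ln \<bar>x - z\<bar>" by (simp add: log_dist_obs_def dist_real_def)
    then have "exp (log_dist_obs z x / 2) = \<bar>x - z\<bar> powr (- 1/2)" using d by (simp add: powr_def)
    also have "\<dots> \<le> h (x - z) + h (z - x)"
      using d h0[of "x - z"] h0[of "z - x"] by (cases "x \<ge> z") (auto simp: h_def abs_if)
    finally show ?thesis by simp
  qed
  have lm[measurable]: "log_dist_obs z \<in> borel_measurable borel"
    unfolding log_dist_obs_def by measurable
  then have em: "(\<lambda>x. exp (log_dist_obs z x / 2)) \<in> borel_measurable borel" by measurable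
  have "(\<integral>\<^sup>+x. ennreal (exp (log_dist_obs z x / 2)) \<partial>M)
      \<le> ennreal C * (\<integral>\<^sup>+x\<in>{0..1}. ennreal (exp (log_dist_obs z x / 2)) \<partial>lborel)"
    using em by (intro bounded_density_nn_integral_le[OF inv dens]) auto
  also have "\<dots> \<le> ennreal C
      * (\<integral>\<^sup>+x. indicator {0..1} x + ennreal (h (x - z)) + ennreal (h (z - x)) \<partial>lborel)"
  proof (intro mult_left_mono nn_integral_mono)
    fix x
    have "ennreal (exp (log_dist_obs z x / 2)) \<le> 1 + ennreal (h (x - z)) + ennreal (h (z - x))"
      if "x \<in> {0..1}"
    proof -
      have "ennreal (exp (log_dist_obs z x / 2)) \<le> ennreal (1 + h (x - z) + h (z - x))"
        using bound[OF that] by (rule ennreal_leI)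
      then show ?thesis using h0 by simp
    qed
    then show "ennreal (exp (log_dist_obs z x / 2)) * indicator {0..1} x
        \<le> indicator {0..1} x + ennreal (h (x - z)) + ennreal (h (z - x))"
      by (cases "x \<in> {0..1}") auto
  qed simp
  also have "(\<integral>\<^sup>+x. indicator {0..1} x + ennreal (h (x - z)) + ennreal (h (z - x)) \<partial>lborel)
      = 1 + (\<integral>\<^sup>+x. h (x - z) \<partial>lborel) + (\<integral>\<^sup>+x. h (z - x) \<partial>lborel)"
    by (simp add: nn_integral_add)
  also have "ennreal C * \<dots> < \<infinity>"
    using I1 I2 by (simp add: ennreal_mult_less_top)
  finally have "(\<integral>\<^sup>+x. ennreal (exp (log_dist_obs z x / 2)) \<partial>M) < \<infinity>" .
  then show ?thesis
    using em invariant_prob_space(2)[OF inv] by (intro integrableI_nonneg) auto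
qed

text \<open>Away from \<open>z\<close> this is the observable cut off at height \<open>t\<close>. Capping the distance rather than
  the value makes it Lipschitz at \<open>z\<close> too.\<close>

definition log_trunc :: "real \<Rightarrow> real \<Rightarrow> real \<Rightarrow> real" where
  "log_trunc z t x = - ln (max \<bar>x - z\<bar> (exp (- t)))"

lemma log_trunc_measurable [measurable]: "log_trunc z t \<in> borel_measurable borel"
  unfolding log_trunc_def by measurable

lemma log_trunc_bounds:
  assumes "x \<in> {0..1}" "z \<in> {0..1}" "0 \<le> t"
  shows "0 \<le> log_trunc z t x" and "log_trunc z t x \<le> t"
proof -
  have "max \<bar>x - z\<bar> (exp (- t)) \<le> 1" using assms by auto
  then show "0 \<le> log_trunc z t x" by (simp add: log_trunc_def less_max_iff_disj)
  have "ln (exp (- t)) \<le> ln (max \<bar>x - z\<bar> (exp (- t)))" by (subst ln_le_cancel_iff) (auto simp: less_max_iff_disj)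
  then show "log_trunc z t x \<le> t" by (simp add: log_trunc_def)
qed

lemma log_trunc_eq:
  assumes "x \<in> {0..1}" "z \<in> {0..1}" "exp (- t) \<le> \<bar>x - z\<bar>"
  shows "log_trunc z t x = log_dist_obs z x"
proof -
  have "0 < \<bar>x - z\<bar>" "\<bar>x - z\<bar> \<le> 1"
    using assms less_le_trans[OF exp_gt_zero assms(3)] by auto
  then show ?thesis using assms(3) by (simp add: log_trunc_def log_dist_obs_def dist_real_def max_def)
qed

lemma log_trunc_le:
  assumes "x \<in> {0..1}" "z \<in> {0..1}" "x \<noteq> z"
  shows "log_trunc z t x \<le> log_dist_obs z x"
proof -
  have "0 < \<bar>x - z\<bar>" "\<bar>x - z\<bar> \<le> 1" using assms by auto
  moreover from this have "ln \<bar>x - z\<bar> \<le> ln (max \<bar>x - z\<bar> (exp (- t)))"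
    by (subst ln_le_cancel_iff) (auto simp: less_max_iff_disj)
  ultimately show ?thesis by (simp add: log_trunc_def log_dist_obs_def dist_real_def)
qed

text \<open>The logarithm has Lipschitz constant \<open>exp t\<close> to the right of \<open>exp (- t)\<close>.\<close>

lemma log_trunc_lipschitz: "\<bar>log_trunc z t x - log_trunc z t y\<bar> \<le> exp t * \<bar>x - y\<bar>"
proof -
  have *: "log_trunc z t y - log_trunc z t x \<le> exp t * \<bar>x - y\<bar>" for x y
  proof -
    define u v where "u = max \<bar>x - z\<bar> (exp (- t))" and "v = max \<bar>y - z\<bar> (exp (- t))"
    have v: "exp (- t) \<le> v" and u0: "0 < u" and v0: "0 < v"
      by (auto simp: u_def v_def less_max_iff_disj)
    have uv: "u - v \<le> \<bar>x - y\<bar>" by (auto simp: u_def v_def max_def)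
    have "ln u - ln v = ln (u / v)" using u0 v0 by (simp add: ln_div)
    also have "\<dots> \<le> u / v - 1" using u0 v0 by (intro ln_le_minus_one) auto
    also have "\<dots> = (u - v) / v" using v0 by (simp add: field_simps)
    also have "\<dots> \<le> \<bar>x - y\<bar> / v" using uv v0 by (intro divide_right_mono) auto
    also have "\<dots> \<le> \<bar>x - y\<bar> / exp (- t)" using v v0 by (intro divide_left_mono) auto
    also have "\<dots> = exp t * \<bar>x - y\<bar>" by (simp add: exp_minus field_simps)
    finally show ?thesis by (simp add: log_trunc_def u_def v_def)
  qed
  show ?thesis using *[of x y] *[of y x] by (simp add: abs_le_iff abs_minus_commute)
qed

lemma exp_moment_integrable:
  fixes u :: "'a \<Rightarrow> real"
  assumes u: "u \<in> borel_measurable M" "\<And>x. x \<in> space M \<Longrightarrow> 0 \<le> u x"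
    and int: "integrable M (\<lambda>x. exp (u x / 2))"
  shows "integrable M u"
proof (rule Bochner_Integration.integrable_bound)
  show "integrable M (\<lambda>x. 2 * exp (u x / 2))" using int by simp
  have "norm (u x) \<le> norm (2 * exp (u x / 2))" if "x \<in> space M" for x
  proof -
    have "u x \<le> 2 * exp (u x / 2)" using exp_ge_add_one_self[of "u x / 2"] by linarith
    then show ?thesis using u(2)[OF that] by simp
  qed
  then show "AE x in M. norm (u x) \<le> norm (2 * exp (u x / 2))" by auto
qed (rule u(1))

text \<open>At every point other than \<open>z\<close> the truncations agree with the observable from some height on,
  and the observable dominates them.\<close>

lemma log_trunc_integral_tendsto:
  assumes inv: "invariant_prob M T" and dens: "bounded_density M C" and z: "z \<in> {0..1}"
  shows "((\<lambda>t. \<integral>x. log_trunc z t x \<partial>M) \<longlongrightarrow> (\<integral>x. log_dist_obs z x \<partial>M)) at_top"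
proof (rule integral_dominated_convergence_at_top)
  note sp = invariant_prob_space[OF inv]
  have "log_dist_obs z \<in> borel_measurable borel" unfolding log_dist_obs_def by measurable
  then show lm: "log_dist_obs z \<in> borel_measurable M" using sp(2) by auto
  show "log_trunc z t \<in> borel_measurable M" for t using sp(2) log_trunc_measurable by auto
  show "integrable M (log_dist_obs z)"
    by (rule exp_moment_integrable[OF lm _ log_dist_obs_exp_moment[OF assms]])
       (simp add: log_dist_obs_def)
  note ae = bounded_density_AE_neq[OF inv dens, of z]
  show "\<forall>\<^sub>F t in at_top. AE x in M. norm (log_trunc z t x) \<le> log_dist_obs z x"
    using eventually_ge_at_top[of 0]
  proof eventually_elim
    case (elim t)
    show ?case using ae AE_space
      by eventually_elim (use log_trunc_bounds(1) log_trunc_le z elim sp(1) in auto)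
  qed
  show "AE x in M. ((\<lambda>t. log_trunc z t x) \<longlongrightarrow> log_dist_obs z x) at_top"
    using ae AE_space
  proof eventually_elim
    case (elim x)
    then have d: "0 < \<bar>x - z\<bar>" and x: "x \<in> {0..1}" using sp(1) by auto
    have "\<forall>\<^sub>F t in at_top. log_trunc z t x = log_dist_obs z x"
      using eventually_ge_at_top[of "- ln \<bar>x - z\<bar>"]
    proof eventually_elim
      case (elim t)
      then have "exp (- t) \<le> exp (ln \<bar>x - z\<bar>)" by (subst exp_le_cancel_iff) simp
      then show ?case using d by (intro log_trunc_eq[OF x z]) simp
    qed
    then show ?case by (rule tendsto_eventually)
  qed
qed

section \<open>Exponential moments of the truncated observable\<close>

text \<open>Second-order Taylor expansion of the exponential at 0; the quadratic remainder is absorbed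
  into \<open>exp (u / 2)\<close>, because \<open>u\<^sup>2 / 32 \<le> exp (u / 4)\<close>.\<close>

lemma exp_scaled_le:
  fixes u s l :: real
  assumes u: "0 \<le> u" and l: "0 \<le> l" "l \<le> 1/4" and s: "\<bar>s\<bar> = 1"
  shows "exp (l * s * u) \<le> 1 + l * s * u + 16 * l\<^sup>2 * exp (u / 2)"
proof -
  define y where "y = l * s * u"
  have yu: "\<bar>y\<bar> \<le> u / 4"
    using u l s mult_right_mono[of l "1/4" u] by (simp add: y_def abs_mult)
  have ys: "y\<^sup>2 = l\<^sup>2 * u\<^sup>2"
    using s by (simp add: y_def power_mult_distrib flip: power2_abs[of s])
  obtain r where r: "\<bar>r\<bar> \<le> \<bar>y\<bar>" "exp y = (\<Sum>m<2. y ^ m / fact m) + exp r / fact 2 * y ^ 2"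
    using Maclaurin_exp_le[of y 2] by blast
  have "exp r \<le> exp (u / 4)" using r(1) yu by simp
  moreover have "u\<^sup>2 \<le> 32 * exp (u / 4)"
    using exp_lower_Taylor_quadratic[of "u / 4"] u by (simp add: power2_eq_square)
  ultimately have "exp r * u\<^sup>2 \<le> exp (u / 4) * (32 * exp (u / 4))" by (intro mult_mono) auto
  also have "\<dots> = 32 * exp (u / 2)" by (simp flip: exp_add)
  finally have "l\<^sup>2 * (exp r * u\<^sup>2) \<le> l\<^sup>2 * (32 * exp (u / 2))" by (intro mult_left_mono) auto
  then have "exp r / 2 * y\<^sup>2 \<le> 16 * l\<^sup>2 * exp (u / 2)" unfolding ys by (simp add: algebra_simps)
  then show ?thesis using r(2) by (simp add: y_def numeral_2_eq_2)
qed

lemma exp_moment_le: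
  fixes u :: "'a \<Rightarrow> real"
  assumes M: "prob_space M" and u: "u \<in> borel_measurable M" "\<And>x. x \<in> space M \<Longrightarrow> 0 \<le> u x"
    and int: "integrable M (\<lambda>x. exp (u x / 2))"
    and l: "0 \<le> l" "l \<le> 1/4" and s: "\<bar>s\<bar> = 1"
  shows "(\<integral>x. exp (l * s * u x) \<partial>M)
    \<le> exp (l * s * (\<integral>x. u x \<partial>M) + 16 * l\<^sup>2 * (\<integral>x. exp (u x / 2) \<partial>M))"
proof -
  interpret prob_space M by fact
  note intu = exp_moment_integrable[OF u int]
  have "(\<integral>x. exp (l * s * u x) \<partial>M) \<le> (\<integral>x. 1 + l * s * u x + 16 * l\<^sup>2 * exp (u x / 2) \<partial>M)"
  proof (rule integral_mono)
    show R: "integrable M (\<lambda>x. 1 + l * s * u x + 16 * l\<^sup>2 * exp (u x / 2))"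
      using intu int by auto
    show le: "exp (l * s * u x) \<le> 1 + l * s * u x + 16 * l\<^sup>2 * exp (u x / 2)"
      if "x \<in> space M" for x
      using exp_scaled_le u(2)[OF that] l s by blast
    show "integrable M (\<lambda>x. exp (l * s * u x))"
      by (rule Bochner_Integration.integrable_bound[OF R])
         (use u(1) le in \<open>auto intro!: AE_I2 order_trans[OF _ abs_ge_self]\<close>)
  qed
  also have "\<dots> = 1 + (l * s * (\<integral>x. u x \<partial>M) + 16 * l\<^sup>2 * (\<integral>x. exp (u x / 2) \<partial>M))"
    using intu int by (simp add: prob_space)
  also have "\<dots> \<le> exp (l * s * (\<integral>x. u x \<partial>M) + 16 * l\<^sup>2 * (\<integral>x. exp (u x / 2) \<partial>M))"
    by (rule exp_ge_add_one_self)
  finally show ?thesis .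
qed

lemma abs_exp_diff_le:
  fixes a b c :: real
  assumes "a \<le> c" "b \<le> c"
  shows "\<bar>exp a - exp b\<bar> \<le> exp c * \<bar>a - b\<bar>"
proof -
  have *: "exp x - exp y \<le> exp c * \<bar>x - y\<bar>" if "x \<le> c" for x y :: real
  proof -
    have "exp x - exp y = exp x * (1 - exp (y - x))" by (simp add: exp_diff field_simps)
    also have "\<dots> \<le> exp x * \<bar>x - y\<bar>"
    proof (rule mult_left_mono)
      show "1 - exp (y - x) \<le> \<bar>x - y\<bar>" using exp_ge_add_one_self[of "y - x"] by linarith
    qed simp
    also have "\<dots> \<le> exp c * \<bar>x - y\<bar>" using that by (intro mult_right_mono) auto
    finally show ?thesis .
  qed
  show ?thesis using *[OF assms(1), of b] *[OF assms(2), of a] by (auto simp: abs_le_iff abs_minus_commute)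
qed

text \<open>The sign \<open>s\<close> selects the tail. Because \<open>l\<close> is bounded independently of the height \<open>t\<close>, the
  truncation enters only through the factor \<open>exp (2 * t)\<close> in the Hoelder norm, and the gap \<open>p\<close>
  can pay for that factor.\<close>

lemma trunc_birkhoff_tail:
  fixes l s \<epsilon> t :: real
  assumes \<alpha>: "0 < \<alpha>" "\<alpha> \<le> 1" and inv: "invariant_prob M T" and L: "transfer_operator M T L"
    and dens: "bounded_density M C\<^sub>\<mu>" and z: "z \<in> {0..1}"
    and C: "0 \<le> C"
    and decay: "\<And>n f. holder_fun \<alpha> f \<Longrightarrow> (\<integral>x. f x \<partial>M) = 0 \<Longrightarrow>
      \<exists>h. holder_fun \<alpha> h \<and> (AE x in M. h x = (L ^^ n) f x) \<and>
          holder_norm \<alpha> h \<le> C * exp (- \<theta> * real n) * holder_norm \<alpha> f"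
    and m: "m = (\<integral>x. log_dist_obs z x \<partial>M)"
    and l: "0 < l" "l \<le> 1/4" "16 * l * (\<integral>x. exp (log_dist_obs z x / 2) \<partial>M) \<le> \<epsilon> / 4"
    and s: "\<bar>s\<bar> = 1" and \<epsilon>: "0 < \<epsilon>" and t: "0 \<le> t"
    and mt: "\<bar>(\<integral>x. log_trunc z t x \<partial>M) - m\<bar> \<le> \<epsilon> / 4"
    and a: "exp (- l * \<epsilon> / 2) + C * exp (- \<theta> * real p) * (2 * exp (2 * t + \<bar>m\<bar>)) \<le> a" "a \<le> 1"
    and p: "0 < p"
  shows "measure M {x \<in> space M.
      birkhoff_sum T n (\<lambda>x. l * (s * (log_trunc z t x - m) - \<epsilon>)) x > 0} \<le> real p * a ^ (n div p)"
proof -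
  interpret prob_space M using inv by (simp add: invariant_prob_def)
  note sp = invariant_prob_space[OF inv]
  have trm: "log_trunc z t \<in> borel_measurable M" using sp(2) log_trunc_measurable by auto
  have tr: "0 \<le> log_trunc z t x \<and> log_trunc z t x \<le> t" if "x \<in> {0..1}" for x
    using log_trunc_bounds[OF that z t] by auto
  define w where "w x = l * (s * (log_trunc z t x - m) - \<epsilon>)" for x
  have wm: "w \<in> borel_measurable M" unfolding w_def using trm by measurable
  have wb: "w x \<le> t + \<bar>m\<bar>" if "x \<in> {0..1}" for x
  proof -
    have "s * (log_trunc z t x - m) \<le> \<bar>s * (log_trunc z t x - m)\<bar>" by simp
    also have "\<dots> = \<bar>log_trunc z t x - m\<bar>" using s by (simp add: abs_mult)
    also have "\<dots> \<le> t + \<bar>m\<bar>" using tr[OF that] by linarith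
    finally have "w x \<le> l * (t + \<bar>m\<bar>)" unfolding w_def using l \<epsilon> by (intro mult_left_mono) auto
    also have "\<dots> \<le> 1 * (t + \<bar>m\<bar>)" using l t by (intro mult_right_mono) auto
    finally show ?thesis by simp
  qed
  have wlip: "\<bar>w x - w y\<bar> \<le> exp t * \<bar>x - y\<bar>" for x y
  proof -
    have "w x - w y = l * (s * (log_trunc z t x - log_trunc z t y))"
      by (simp add: w_def algebra_simps)
    then have "\<bar>w x - w y\<bar> = l * \<bar>log_trunc z t x - log_trunc z t y\<bar>"
      using l s by (simp add: abs_mult)
    also have "\<dots> \<le> 1 * (exp t * \<bar>x - y\<bar>)"
      using l log_trunc_lipschitz by (intro mult_mono) auto
    finally show ?thesis by simp
  qed
  have elip: "\<bar>exp (w x) - exp (w y)\<bar> \<le> exp (2 * t + \<bar>m\<bar>) * \<bar>x - y\<bar>"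
    if "x \<in> {0..1}" "y \<in> {0..1}" for x y
  proof -
    have "\<bar>exp (w x) - exp (w y)\<bar> \<le> exp (t + \<bar>m\<bar>) * \<bar>w x - w y\<bar>"
      using wb that by (intro abs_exp_diff_le) auto
    also have "\<dots> \<le> exp (t + \<bar>m\<bar>) * (exp t * \<bar>x - y\<bar>)" using wlip by (intro mult_left_mono) auto
    also have "\<dots> = exp (2 * t + \<bar>m\<bar>) * \<bar>x - y\<bar>" by (simp flip: exp_add add: algebra_simps)
    finally show ?thesis .
  qed
  have eb: "0 \<le> exp (w x) \<and> exp (w x) \<le> exp (2 * t + \<bar>m\<bar>)" if "x \<in> {0..1}" for x
    using wb[OF that] t by auto
  have mgf: "(\<integral>x. exp (w x) \<partial>M) \<le> exp (- l * \<epsilon> / 2)"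
  proof -
    define J where "J = (\<integral>x. exp (log_dist_obs z x / 2) \<partial>M)"
    define I where "I = (\<integral>x. log_trunc z t x \<partial>M)"
    have tint: "integrable M (\<lambda>x. exp (log_trunc z t x / 2))"
      using trm tr sp(1) by (intro integrable_const_bound[of _ "exp (t / 2)"] AE_I2) auto
    have "(\<integral>x. exp (log_trunc z t x / 2) \<partial>M) \<le> J"
      unfolding J_def
    proof (rule integral_mono_AE[OF tint log_dist_obs_exp_moment[OF inv dens z]])
      show "AE x in M. exp (log_trunc z t x / 2) \<le> exp (log_dist_obs z x / 2)"
        using bounded_density_AE_neq[OF inv dens, of z] AE_space
        by eventually_elim (use log_trunc_le z sp(1) in auto)
    qed
    then have "16 * l\<^sup>2 * (\<integral>x. exp (log_trunc z t x / 2) \<partial>M) \<le> 16 * l\<^sup>2 * J"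
      by (intro mult_left_mono) auto
    also have "\<dots> = l * (16 * l * J)" by (simp add: power2_eq_square)
    also have "\<dots> \<le> l * (\<epsilon> / 4)" using l by (intro mult_left_mono) (auto simp: J_def)
    finally have q: "16 * l\<^sup>2 * (\<integral>x. exp (log_trunc z t x / 2) \<partial>M) \<le> l * (\<epsilon> / 4)" .
    have "s * (I - m) \<le> \<bar>s * (I - m)\<bar>" by simp
    also have "\<dots> \<le> \<epsilon> / 4" using mt s by (simp add: abs_mult I_def)
    finally have r: "l * (s * (I - m)) \<le> l * (\<epsilon> / 4)" using l by (intro mult_left_mono) auto
    have "exp (w x) = exp (- l * (s * m + \<epsilon>)) * exp (l * s * log_trunc z t x)" for x
      by (simp add: w_def algebra_simps flip: exp_add)
    then have "(\<integral>x. exp (w x) \<partial>M)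
        = exp (- l * (s * m + \<epsilon>)) * (\<integral>x. exp (l * s * log_trunc z t x) \<partial>M)" by simp
    also have "\<dots> \<le> exp (- l * (s * m + \<epsilon>)) *
        exp (l * s * I + 16 * l\<^sup>2 * (\<integral>x. exp (log_trunc z t x / 2) \<partial>M))"
      unfolding I_def using l s tr sp(1)
      by (intro mult_left_mono exp_moment_le[OF prob_space_axioms trm _ tint]) auto
    also have "\<dots> = exp (l * (s * (I - m)) - l * \<epsilon>
        + 16 * l\<^sup>2 * (\<integral>x. exp (log_trunc z t x / 2) \<partial>M))"
      by (simp add: algebra_simps flip: exp_add)
    also have "\<dots> \<le> exp (- l * \<epsilon> / 2)" using q r by simp
    finally show ?thesis .
  qed
  have "measure M {x \<in> space M. birkhoff_sum T n w x > 0} \<le> real p * a ^ (n div p)"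
  proof (rule birkhoff_sum_positive_prob[OF inv _ a(2) p wm])
    have "0 \<le> C * exp (- \<theta> * real p) * (2 * exp (2 * t + \<bar>m\<bar>))" using C by simp
    then show "0 \<le> a" using a(1) exp_ge_zero[of "- l * \<epsilon> / 2"] by linarith
    show "exp (w x) \<le> exp (2 * t + \<bar>m\<bar>)" if "x \<in> space M" for x using eb that sp(1) by auto
    fix g :: "real \<Rightarrow> real" and D :: real
    assume g: "g \<in> borel_measurable M" "\<And>x. x \<in> space M \<Longrightarrow> 0 \<le> g x \<and> g x \<le> D"
    have "(\<integral>x. exp (w x) * g ((T ^^ p) x) \<partial>M)
      \<le> ((\<integral>x. exp (w x) \<partial>M) + C * exp (- \<theta> * real p) * (exp (2 * t + \<bar>m\<bar>) + exp (2 * t + \<bar>m\<bar>)))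
        * (\<integral>x. g x \<partial>M)"
      by (rule holder_decay_decorrelation[OF \<alpha> inv L C decay _ eb elip g]) (use wm in measurable)
    also have "\<dots> \<le> a * (\<integral>x. g x \<partial>M)"
      using mgf a(1) g(2) by (intro mult_right_mono Bochner_Integration.integral_nonneg) auto
    finally show "(\<integral>x. exp (w x) * g ((T ^^ p) x) \<partial>M) \<le> a * (\<integral>x. g x \<partial>M)" .
  qed
  then show ?thesis by (simp add: w_def[abs_def])
qed

section \<open>Returning to the unbounded observable\<close>

lemma orbit_near_prob:
  assumes inv: "invariant_prob M T" and dens: "bounded_density M C" and \<delta>: "0 \<le> \<delta>"
  shows "{x \<in> space M. \<exists>k<n. \<bar>(T ^^ k) x - z\<bar> < \<delta>} \<in> sets M"
    and "measure M {x \<in> space M. \<exists>k<n. \<bar>(T ^^ k) x - z\<bar> < \<delta>} \<le> real n * (\<bar>C\<bar> * (2 * \<delta>))"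
proof -
  interpret prob_space M using inv by (simp add: invariant_prob_def)
  have id: "(\<lambda>x. x) \<in> borel_measurable M" using invariant_prob_space(2)[OF inv] by auto
  define B where "B = {x \<in> space M. \<bar>x - z\<bar> < \<delta>}"
  define A where "A k = (T ^^ k) -` B \<inter> space M" for k
  have B: "B \<in> sets M" unfolding B_def using id by measurable
  note Tk = invariant_prob_iterate[OF inv]
  have A: "A k \<in> sets M" for k unfolding A_def using measurable_sets[OF Tk(1) B] .
  have mA: "measure M (A k) = measure M B" for k
    using measure_distr[OF Tk(1) B, of k] unfolding Tk(2) A_def by simp
  have eq: "{x \<in> space M. \<exists>k<n. \<bar>(T ^^ k) x - z\<bar> < \<delta>} = (\<Union>k<n. A k)"
    using measurable_space[OF Tk(1)] by (auto simp: A_def B_def)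
  show "{x \<in> space M. \<exists>k<n. \<bar>(T ^^ k) x - z\<bar> < \<delta>} \<in> sets M" unfolding eq using A by auto
  have "measure M (\<Union>k<n. A k) \<le> (\<Sum>k<n. measure M (A k))"
    using A by (intro finite_measure_subadditive_finite) auto
  also have "\<dots> = real n * measure M B" by (simp add: mA)
  also have "\<dots> \<le> real n * (\<bar>C\<bar> * (2 * \<delta>))"
    unfolding B_def using bounded_density_ball_prob[OF inv dens \<delta>] by (intro mult_left_mono) auto
  finally show "measure M {x \<in> space M. \<exists>k<n. \<bar>(T ^^ k) x - z\<bar> < \<delta>} \<le> real n * (\<bar>C\<bar> * (2 * \<delta>))"
    unfolding eq .
qed

text \<open>Along an orbit that stays at distance at least \<open>exp (- t)\<close> from \<open>z\<close> the observable equals its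
  truncation, so a large deviation makes one of the two centred truncated sums exceed
  \<open>n * \<epsilon>\<close>.\<close>

lemma log_deviation_subset:
  fixes l \<epsilon> t m :: real
  assumes inv: "invariant_prob M T" and z: "z \<in> {0..1}" and l: "0 < l"
  shows "{x \<in> space M. \<bar>birkhoff_sum T n (\<lambda>y. log_dist_obs z y - m) x\<bar> > real n * \<epsilon>}
    \<subseteq> {x \<in> space M. \<exists>k<n. \<bar>(T ^^ k) x - z\<bar> < exp (- t)}
      \<union> {x \<in> space M. birkhoff_sum T n (\<lambda>x. l * (1 * (log_trunc z t x - m) - \<epsilon>)) x > 0}
      \<union> {x \<in> space M. birkhoff_sum T n (\<lambda>x. l * (- 1 * (log_trunc z t x - m) - \<epsilon>)) x > 0}"
proof
  fix x assume x: "x \<in> {x \<in> space M. \<bar>birkhoff_sum T n (\<lambda>y. log_dist_obs z y - m) x\<bar> > real n * \<epsilon>}"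
  define S where "S = birkhoff_sum T n (\<lambda>y. log_dist_obs z y - m) x"
  have orb: "(T ^^ k) x \<in> {0..1}" for k
    using measurable_space[OF invariant_prob_iterate(1)[OF inv]] x invariant_prob_space(1)[OF inv]
    by blast
  have "\<exists>k<n. \<bar>(T ^^ k) x - z\<bar> < exp (- t)" if neg:
           "\<not> birkhoff_sum T n (\<lambda>x. l * (1 * (log_trunc z t x - m) - \<epsilon>)) x > 0"
    "\<not> birkhoff_sum T n (\<lambda>x. l * (- 1 * (log_trunc z t x - m) - \<epsilon>)) x > 0"
  proof (rule ccontr)
    assume "\<not> (\<exists>k<n. \<bar>(T ^^ k) x - z\<bar> < exp (- t))"
    then have eq: "log_trunc z t ((T ^^ k) x) = log_dist_obs z ((T ^^ k) x)" if "k < n" for k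
      using log_trunc_eq[OF orb z] that by force
    have sum: "birkhoff_sum T n (\<lambda>x. l * (s * (log_trunc z t x - m) - \<epsilon>)) x = l * (s * S - real n * \<epsilon>)"
      for s
    proof -
      have "birkhoff_sum T n (\<lambda>x. l * (s * (log_trunc z t x - m) - \<epsilon>)) x
        = (\<Sum>k<n. l * (s * (log_dist_obs z ((T ^^ k) x) - m) - \<epsilon>))"
        unfolding birkhoff_sum_def using eq by (intro sum.cong) auto
      also have "\<dots> = l * (s * S - real n * \<epsilon>)"
        by (simp add: S_def birkhoff_sum_def sum_distrib_left[symmetric] sum_subtractf)
      finally show ?thesis .
    qed
    have "s * S \<le> real n * \<epsilon>" if "\<not> l * (s * S - real n * \<epsilon>) > 0" for s
      using that l by (simp add: zero_less_mult_iff not_less)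
    from this[of 1] this[of "- 1"] neg have "\<bar>S\<bar> \<le> real n * \<epsilon>"
      unfolding sum by simp
    then show False using x by (simp add: S_def)
  qed
  then show "x \<in> {x \<in> space M. \<exists>k<n. \<bar>(T ^^ k) x - z\<bar> < exp (- t)}
      \<union> {x \<in> space M. birkhoff_sum T n (\<lambda>x. l * (1 * (log_trunc z t x - m) - \<epsilon>)) x > 0}
      \<union> {x \<in> space M. birkhoff_sum T n (\<lambda>x. l * (- 1 * (log_trunc z t x - m) - \<epsilon>)) x > 0}"
    using x by blast
qed

theorem theorem4p1:
  fixes M :: "real measure" and T :: "real \<Rightarrow> real"
    and L :: "(real \<Rightarrow> real) \<Rightarrow> real \<Rightarrow> real"
    and \<alpha> C\<^sub>\<mu> z :: real
  assumes "0 < \<alpha>" and "\<alpha> \<le> 1"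
    and "invariant_prob M T"
    and "bounded_density M C\<^sub>\<mu>"
    and "z \<in> {0..1}"
    and "transfer_operator M T L"
    and "holder_exp_decay M \<alpha> L"
  shows "\<forall>\<epsilon>>0. \<exists>n0::nat. \<exists>c>0. \<forall>n\<ge>n0.
    measure M {x \<in> space M.
        \<bar>birkhoff_sum T n (\<lambda>y. log_dist_obs z y - (\<integral>u. log_dist_obs z u \<partial>M)) x\<bar> > real n * \<epsilon>}
      \<le> exp (- c * \<epsilon> * real n powr (1 / 3))"
proof (intro allI impI)
  fix \<epsilon> :: real assume \<epsilon>: "\<epsilon> > 0"
  note \<alpha> = assms(1,2) and inv = assms(3) and dens = assms(4) and z = assms(5) and L = assms(6)
  interpret prob_space M using inv by (simp add: invariant_prob_def)
  note sp = invariant_prob_space[OF inv]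
  obtain \<theta> C where \<theta>: "0 < \<theta>" and C: "0 < C" and
    decay: "\<And>n f. holder_fun \<alpha> f \<Longrightarrow> (\<integral>x. f x \<partial>M) = 0 \<Longrightarrow>
      \<exists>h. holder_fun \<alpha> h \<and> (AE x in M. h x = (L ^^ n) f x) \<and>
          holder_norm \<alpha> h \<le> C * exp (- \<theta> * real n) * holder_norm \<alpha> f"
    using assms(7) unfolding holder_exp_decay_def by blast
  define m where "m = (\<integral>x. log_dist_obs z x \<partial>M)"
  define J where "J = (\<integral>x. exp (log_dist_obs z x / 2) \<partial>M)"
  have J: "0 \<le> J" unfolding J_def by simp
  define l where "l = min (1/4) (\<epsilon> / (64 * (J + 1)))"
  have "0 < \<epsilon> / (64 * (J + 1))" using \<epsilon> J by simp
  then have "0 < l" unfolding l_def by (simp only: min_less_iff_conj) simp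
  moreover have "l \<le> 1/4" unfolding l_def by (rule min.cobounded1)
  ultimately have l: "0 < l" "l \<le> 1/4" by blast+
  have lJ: "16 * l * J \<le> \<epsilon> / 4"
  proof -
    have "l \<le> \<epsilon> / (64 * (J + 1))" unfolding l_def by (rule min.cobounded2)
    then have "l * (64 * (J + 1)) \<le> \<epsilon>" using J by (subst (asm) pos_le_divide_eq) auto
    then show ?thesis using l by (simp add: algebra_simps)
  qed
  define \<kappa> where "\<kappa> = l * \<epsilon> / 4"
  have \<kappa>: "0 < \<kappa>" using l \<epsilon> by (simp add: \<kappa>_def)
  define E where "E = C * (2 * exp \<bar>m\<bar>)"
  have E: "0 < E" using C by (simp add: E_def)
  define t where "t n = real n powr (1 / 3)" for n
  \<comment> \<open>The gap: \<open>exp (- \<theta> * p) \<le> exp (- 3 * t)\<close> beats the growth \<open>exp (2 * t)\<close> of the Hoelder norm.\<close>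
  define p where "p n = Suc (nat \<lceil>3 * t n / \<theta>\<rceil>)" for n
  have t0: "0 \<le> t n" for n by (simp add: t_def)
  have p: "3 * t n / \<theta> \<le> real (p n)" "real (p n) \<le> 3 * t n / \<theta> + 2" for n
  proof -
    have "0 \<le> 3 * t n / \<theta>" using t0 \<theta> by simp
    then show "3 * t n / \<theta> \<le> real (p n)" "real (p n) \<le> 3 * t n / \<theta> + 2"
      unfolding p_def by linarith+
  qed
  have tinf: "filterlim t at_top sequentially" unfolding t_def by real_asymp
  have ev_mean: "\<forall>\<^sub>F n in sequentially. \<bar>(\<integral>x. log_trunc z (t n) x \<partial>M) - m\<bar> \<le> \<epsilon> / 4"
  proof -
    have "(\<lambda>n. \<integral>x. log_trunc z (t n) x \<partial>M) \<longlonglongrightarrow> m"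
      unfolding m_def by (rule filterlim_compose[OF log_trunc_integral_tendsto[OF inv dens z] tinf])
    from tendstoD[OF this, of "\<epsilon> / 4"] show ?thesis
      using \<epsilon> by (auto simp: dist_real_def elim: eventually_mono)
  qed
  have "exp (- 2 * \<kappa>) < exp (- \<kappa>)" using \<kappa> by simp
  moreover have "(\<lambda>n. exp (- 2 * \<kappa>) + E * exp (- t n)) \<longlonglongrightarrow> exp (- 2 * \<kappa>)"
    unfolding t_def by real_asymp
  ultimately have ev_a: "\<forall>\<^sub>F n in sequentially. exp (- 2 * \<kappa>) + E * exp (- t n) < exp (- \<kappa>)"
    by (metis order_tendstoD(2))
  have ev_fin: "\<forall>\<^sub>F n in sequentially. real n * (\<bar>C\<^sub>\<mu>\<bar> * (2 * exp (- t n)))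
      + 2 * ((3 * t n / \<theta> + 2) * exp (- \<kappa> * (real n / (3 * t n / \<theta> + 2) - 1))) \<le> exp (- t n / 2)"
    unfolding t_def using \<theta> \<kappa> by real_asymp
  have "\<forall>\<^sub>F n in sequentially. measure M {x \<in> space M.
        \<bar>birkhoff_sum T n (\<lambda>y. log_dist_obs z y - m) x\<bar> > real n * \<epsilon>} \<le> exp (- t n / 2)"
    using ev_mean ev_a ev_fin
  proof eventually_elim
    case (elim n)
    let ?W = "\<lambda>s. {x \<in> space M. birkhoff_sum T n (\<lambda>x. l * (s * (log_trunc z (t n) x - m) - \<epsilon>)) x > 0}"
    let ?N = "{x \<in> space M. \<exists>k<n. \<bar>(T ^^ k) x - z\<bar> < exp (- t n)}"
    have "exp (- \<theta> * real (p n)) \<le> exp (- 3 * t n)"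
      using p(1)[of n] \<theta> by (simp add: field_simps)
    then have "C * exp (- \<theta> * real (p n)) * (2 * exp (2 * t n + \<bar>m\<bar>))
        \<le> C * exp (- 3 * t n) * (2 * exp (2 * t n + \<bar>m\<bar>))"
      using C by (intro mult_right_mono mult_left_mono) auto
    also have "\<dots> = E * (exp (- 3 * t n) * exp (2 * t n))"
      by (simp add: E_def exp_add)
    also have "\<dots> = E * exp (- t n)" by (simp flip: exp_add)
    finally have a: "exp (- l * \<epsilon> / 2) + C * exp (- \<theta> * real (p n)) * (2 * exp (2 * t n + \<bar>m\<bar>))
        \<le> exp (- \<kappa>)" using elim(2) by (simp add: \<kappa>_def mult.commute[of l])
    have W: "measure M (?W s) \<le> (3 * t n / \<theta> + 2) * exp (- \<kappa> * (real n / (3 * t n / \<theta> + 2) - 1))"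
      if "\<bar>s\<bar> = 1" for s
    proof -
      have "measure M (?W s) \<le> real (p n) * exp (- \<kappa>) ^ (n div p n)"
        by (rule trunc_birkhoff_tail[OF \<alpha> inv L dens z _ decay m_def l lJ[unfolded J_def] that \<epsilon> t0 _ a])
           (use C \<kappa> elim(1) in \<open>auto simp: p_def\<close>)
      also have "exp (- \<kappa>) ^ (n div p n) = exp (- \<kappa> * real (n div p n))"
        by (simp add: exp_of_nat_mult[symmetric] mult.commute)
      also have "real (p n) * \<dots> \<le> (3 * t n / \<theta> + 2) * exp (- \<kappa> * (real n / (3 * t n / \<theta> + 2) - 1))"
      proof (rule mult_mono)
        have pp: "0 < real (p n)" by (simp add: p_def)
        have "real n / (3 * t n / \<theta> + 2) \<le> real n / real (p n)"
          using p(2)[of n] pp by (intro divide_left_mono) auto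
        also have "\<dots> \<le> real (n div p n) + 1"
          using floor_divide_of_nat_eq[where 'a = real, of n "p n"] by linarith
        finally show "exp (- \<kappa> * real (n div p n)) \<le> exp (- \<kappa> * (real n / (3 * t n / \<theta> + 2) - 1))"
          using \<kappa> by simp
      qed (use p(2)[of n] t0[of n] \<theta> in auto)
      finally show ?thesis .
    qed
    have trm: "log_trunc z (t n) \<in> borel_measurable M" using sp(2) log_trunc_measurable by auto
    have Wm: "?W s \<in> sets M" for s
    proof -
      have [measurable]: "(\<lambda>x. log_trunc z (t n) ((T ^^ k) x)) \<in> borel_measurable M" for k
        using measurable_compose[OF invariant_prob_iterate(1)[OF inv] trm] .
      show ?thesis unfolding birkhoff_sum_def by measurable
    qed
    have Nm: "?N \<in> sets M" and N: "measure M ?N \<le> real n * (\<bar>C\<^sub>\<mu>\<bar> * (2 * exp (- t n)))"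
      using orbit_near_prob[OF inv dens exp_ge_zero] by blast+
    have NW: "?N \<union> ?W 1 \<in> sets M" using Nm Wm by (rule sets.Un)
    have "measure M {x \<in> space M. \<bar>birkhoff_sum T n (\<lambda>y. log_dist_obs z y - m) x\<bar> > real n * \<epsilon>}
        \<le> measure M (?N \<union> ?W 1 \<union> ?W (- 1))"
      by (rule finite_measure_mono[OF log_deviation_subset[OF inv z l(1)] sets.Un[OF NW Wm]])
    also have "\<dots> \<le> measure M (?N \<union> ?W 1) + measure M (?W (- 1))"
      by (rule measure_Un_le[OF NW Wm])
    also have "\<dots> \<le> measure M ?N + measure M (?W 1) + measure M (?W (- 1))"
      using measure_Un_le[OF Nm Wm[of 1]] by (rule add_right_mono)
    also have "\<dots> \<le> exp (- t n / 2)"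
      using N W[OF abs_one] W[OF abs_neg_one] elim(3) by linarith
    finally show ?case .
  qed
  then obtain n0 where n0: "\<And>n. n \<ge> n0 \<Longrightarrow> measure M {x \<in> space M.
        \<bar>birkhoff_sum T n (\<lambda>y. log_dist_obs z y - m) x\<bar> > real n * \<epsilon>} \<le> exp (- t n / 2)"
    unfolding eventually_sequentially by blast
  \<comment> \<open>The rate does not depend on \<open>\<epsilon>\<close>; dividing by \<open>\<epsilon>\<close> puts it in the required form.\<close>
  show "\<exists>n0::nat. \<exists>c>0. \<forall>n\<ge>n0. measure M {x \<in> space M.
        \<bar>birkhoff_sum T n (\<lambda>y. log_dist_obs z y - (\<integral>u. log_dist_obs z u \<partial>M)) x\<bar> > real n * \<epsilon>}
      \<le> exp (- c * \<epsilon> * real n powr (1 / 3))"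
  proof (intro exI[of _ n0] exI[of _ "1 / (2 * \<epsilon>)"] conjI allI impI)
    show "0 < 1 / (2 * \<epsilon>)" using \<epsilon> by simp
    fix n assume "n0 \<le> n"
    from n0[OF this] show "measure M {x \<in> space M.
        \<bar>birkhoff_sum T n (\<lambda>y. log_dist_obs z y - (\<integral>u. log_dist_obs z u \<partial>M)) x\<bar> > real n * \<epsilon>}
      \<le> exp (- (1 / (2 * \<epsilon>)) * \<epsilon> * real n powr (1 / 3))"
      using \<epsilon> by (simp add: m_def t_def)
  qed
qed

end
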